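(* Let $0<m<n$ and let $\mathcal{F}$ be a fan in $\mathbb{R}^n$ with $|\mathcal{F}|=|\mathcal{W}_n^m|$. Then for every relatively open cone $\mathring{C}$ of $\mathcal{F}$ there exists a relatively open cone $\mathring{C}_A$ of $\mathcal{W}_n^m$ such that $\mathring{C}\subset\mathring{C}_A$.
   Context: A fan in $\mathbb{R}^n$ is a finite collection of closed convex polyhedral cones, closed under taking faces, such that any two intersect in a common face (a nontrivial lineality space is allowed). $|\mathcal{F}|=\bigcup_{C\in\mathcal{F}}C$, and $\mathring{C}$ is the relative interior of $C$; the relatively open cones of $\mathcal{F}$ are the sets $\mathring{C}$ for $C\in\mathcal{F}$. $\mathcal{W}_n$ is the complete fan in $\mathbb{R}^n$ with cones $C_A=\{\omega\in\mathbb{R}^n:\omega_i=\min_k\omega_k\text{ for all }i\in A\}$, $\emptyset\neq A\subset\{1,\ldots,n\}$ ($\dim C_A=n-|A|+1$); $\mathcal{W}_n^m$ is the fan of all its cones of dimension at most $m$. *)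

theory Defs
  imports "HOL-Analysis.Analysis"
begin

(* conic contains the closure under scaling by all c \<ge> 0; a polyhedron is automatically
   closed and convex. *)
definition polyhedral_cone :: "'a::euclidean_space set \<Rightarrow> bool" where
  "polyhedral_cone C \<longleftrightarrow> C \<noteq> {} \<and> conic C \<and> polyhedron C"

(* The library relation face_of also counts the empty set as a face of every set; faces of
   cones are nonempty, so it is excluded from the face closure condition. The intersection of
   two cones always contains 0, so the last condition never involves the empty face. *)
definition fan :: "'a::euclidean_space set set \<Rightarrow> bool" where
  "fan F \<longleftrightarrow>
     finite F \<and>
     (\<forall>C\<in>F. polyhedral_cone C) \<and>
     (\<forall>C\<in>F. \<forall>D. D face_of C \<and> D \<noteq> {} \<longrightarrow> D \<in> F) \<and>
     (\<forall>C\<in>F. \<forall>D\<in>F. (C \<inter> D) face_of C \<and> (C \<inter> D) face_of D)"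

abbreviation fan_support :: "'a::euclidean_space set set \<Rightarrow> 'a set" where
  "fan_support F \<equiv> \<Union>F"

definition W_cone :: "'n::finite set \<Rightarrow> (real ^ 'n) set" where
  "W_cone A = {\<omega>. \<forall>i\<in>A. \<omega> $ i = Min (range (\<lambda>k. \<omega> $ k))}"

definition W_fan :: "(real ^ 'n::finite) set set" where
  "W_fan = {W_cone A | A. A \<noteq> {}}"

(* dim is the dimension of the linear span; for a cone this is its dimension. *)
definition W_skeleton :: "nat \<Rightarrow> (real ^ 'n::finite) set set" where
  "W_skeleton m = {C \<in> W_fan. dim C \<le> m}"

end

theory Submission
  imports Defs
begin

text \<open>The set of coordinates at which a point \<open>p\<close> of the support \<open>X\<close> is minimal can be read off
  from the local structure of \<open>X\<close> at \<open>p\<close>: for \<open>m < n\<close>, the coordinate \<open>i\<close> is not minimal at \<open>p\<close>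
  if and only if \<open>X\<close> contains a short segment starting at \<open>p\<close> in direction \<open>- e\<^sub>i\<close>. The directions
  in which one can leave \<open>p\<close> inside the support of a fan are the same for all points \<open>p\<close> in the
  relative interior of a given cone. Hence the set of minimal coordinates is constant there.\<close>

definition argmins :: "real ^ 'n::finite \<Rightarrow> 'n set" where
  "argmins x = {i. \<forall>k. x $ i \<le> x $ k}"

lemma argmins_nonempty: "argmins x \<noteq> {}"
proof -
  have "Min (range (\<lambda>k. x $ k)) \<in> range (\<lambda>k. x $ k)"
    by (intro Min_in) auto
  then obtain i where i: "Min (range (\<lambda>k. x $ k)) = x $ i" by (rule rangeE)
  have "x $ i \<le> x $ k" for k
    unfolding i[symmetric] by (rule Min_le) auto
  then have "i \<in> argmins x" by (simp add: argmins_def)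
  then show ?thesis by blast
qed

lemma mem_W_cone_iff: "x \<in> W_cone A \<longleftrightarrow> A \<subseteq> argmins x"
proof -
  have "x $ i = Min (range (\<lambda>k. x $ k)) \<longleftrightarrow> i \<in> argmins x" for i
    unfolding argmins_def by (subst eq_commute, subst Min_eq_iff) auto
  then show ?thesis by (auto simp: W_cone_def)
qed

text \<open>Each index outside \<open>A\<close> must be strictly beaten by some other coordinate, an
  open condition, and there are only finitely many indices.\<close>

lemma open_argmins_subset: "open {x :: real ^ 'n::finite. argmins x \<subseteq> A}"
proof -
  have "argmins x \<subseteq> A \<longleftrightarrow> (\<forall>i\<in>-A. \<exists>k. \<not> x $ i \<le> x $ k)" for x :: "real ^ 'n"
    unfolding argmins_def by blast
  then have eq: "{x :: real ^ 'n. argmins x \<subseteq> A} = (\<Inter>i\<in>-A. \<Union>k. {x. x $ k < x $ i})"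
    by (auto simp: not_le)
  have "open {x :: real ^ 'n. x $ k < x $ i}" for i k
    by (intro open_Collect_less continuous_intros)
  then show ?thesis unfolding eq by (intro open_INT open_UN ballI) auto
qed

text \<open>The cone lies in the subspace \<open>L\<close> of vectors constant on \<open>A\<close>,
  and every point of \<open>L\<close> in the open set \<open>argmins y \<subseteq> A\<close> belongs
  to the cone, so this set witnesses relative interiority of \<open>x\<close>.\<close>

lemma mem_rel_interior_W_cone:
  assumes "A \<noteq> {}" "argmins x = A"
  shows "x \<in> rel_interior (W_cone A)"
proof -
  define L where "L = {y :: real ^ 'a. \<forall>i\<in>A. \<forall>j\<in>A. y $ i = y $ j}"
  have "affine L"
    unfolding affine_def
  proof (intro ballI allI impI)
    fix y z u v assume "y \<in> L" "z \<in> L"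
    then have "y $ i = y $ j" "z $ i = z $ j" if "i \<in> A" "j \<in> A" for i j
      using that unfolding L_def by blast+
    then have "(u *\<^sub>R y + v *\<^sub>R z) $ i = (u *\<^sub>R y + v *\<^sub>R z) $ j" if "i \<in> A" "j \<in> A" for i j
      using that by (metis vector_add_component vector_scaleR_component)
    then show "u *\<^sub>R y + v *\<^sub>R z \<in> L" unfolding L_def by blast
  qed
  moreover have "W_cone A \<subseteq> L"
    unfolding mem_W_cone_iff L_def argmins_def subset_iff by (blast intro: antisym)
  ultimately have hull: "affine hull W_cone A \<subseteq> L" by (simp add: hull_minimal)
  \<comment> \<open>Some minimal coordinate of \<open>y\<close> has its index in \<open>A\<close>;
    constancy on \<open>A\<close> makes all of \<open>A\<close> minimal.\<close>
  have "y \<in> W_cone A" if "argmins y \<subseteq> A" "y \<in> L" for y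
  proof -
    obtain j where "j \<in> argmins y" using argmins_nonempty by blast
    with that have "y $ j \<le> y $ k" "i \<in> A \<Longrightarrow> y $ i = y $ j" for i k
      unfolding argmins_def L_def by blast+
    then have "A \<subseteq> argmins y" by (auto simp: argmins_def)
    then show ?thesis by (simp add: mem_W_cone_iff)
  qed
  with hull assms show ?thesis
    unfolding mem_rel_interior
    by (intro exI[of _ "{y. argmins y \<subseteq> A}"]) (auto simp: open_argmins_subset mem_W_cone_iff)
qed

text \<open>The cone contains a nonempty open set: the points whose only minimal coordinate is
  \<open>i\<close>.\<close>

lemma dim_W_cone_singleton: "dim (W_cone {i} :: (real ^ 'n::finite) set) = CARD('n)"
proof -
  let ?U = "{x :: real ^ 'n. argmins x \<subseteq> {i}}"
  have "?U \<subseteq> W_cone {i}"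
    using argmins_nonempty by (fastforce simp: mem_W_cone_iff)
  moreover have "- axis i 1 \<in> ?U"
    by (auto simp: argmins_def axis_def split: if_splits)
  ultimately have "interior (W_cone {i} :: (real ^ 'n) set) \<noteq> {}"
    using interior_maximal[OF _ open_argmins_subset] by blast
  then show ?thesis
    using empty_interior_lowdim[of "W_cone {i} :: (real ^ 'n) set"]
      dim_subset_UNIV[of "W_cone {i} :: (real ^ 'n) set"]
    by fastforce
qed

lemma argmins_decrease_minimal:
  assumes "i \<in> argmins x" "t > 0"
  shows "argmins (x - t *\<^sub>R axis i 1) = {i}"
proof -
  have le: "x $ i \<le> x $ k" for k using assms by (simp add: argmins_def)
  let ?y = "x - t *\<^sub>R axis i 1"
  have y: "?y $ k = (if k = i then x $ i - t else x $ k)" for k by (simp add: axis_def)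
  have "?y $ i < ?y $ k" if "k \<noteq> i" for k
    using le[of k] \<open>t > 0\<close> that unfolding y by simp
  then have "?y $ i \<le> ?y $ k" "k \<noteq> i \<Longrightarrow> \<not> ?y $ k \<le> ?y $ i" for k
    by (metis less_eq_real_def, metis linorder_not_less)
  then show ?thesis unfolding argmins_def by blast
qed

text \<open>Lowering a coordinate by less than its excess over a smaller one leaves it above the
  minimum, so the old minimal coordinates stay minimal.\<close>

lemma argmins_decrease_nonminimal:
  assumes "i \<notin> argmins x"
  shows "\<forall>\<^sub>F t in at_right 0. argmins x \<subseteq> argmins (x - t *\<^sub>R axis i 1)"
proof -
  obtain k where k: "x $ k < x $ i" using assms by (auto simp: argmins_def not_le)
  have "argmins x \<subseteq> argmins (x - t *\<^sub>R axis i 1)" if "0 < t" "t < x $ i - x $ k" for t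
  proof
    fix j assume j: "j \<in> argmins x"
    then have "x $ j \<le> x $ l" for l by (simp add: argmins_def)
    moreover have "x $ j < x $ i - t"
      using \<open>t < x $ i - x $ k\<close> calculation[of k] by simp
    moreover have "j \<noteq> i" using j assms by blast
    ultimately show "j \<in> argmins (x - t *\<^sub>R axis i 1)"
      by (simp add: argmins_def axis_def less_imp_le)
  qed
  with k show ?thesis
    unfolding eventually_at_right_field by (intro exI[of _ "x $ i - x $ k"]) auto
qed

lemma fan_directions_constant:
  fixes F :: "'a::euclidean_space set set"
  assumes "fan F" "C \<in> F" and p: "p \<in> rel_interior C" and q: "q \<in> rel_interior C"
    and ev: "\<forall>\<^sub>F t in at_right 0. p + t *\<^sub>R v \<in> fan_support F"
  shows "\<exists>s>0. q + s *\<^sub>R v \<in> fan_support F"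
proof -
  have cone: "polyhedron D" if "D \<in> F" for D
    using \<open>fan F\<close> that by (auto simp: fan_def polyhedral_cone_def)
  \<comment> \<open>Finitely many closed cones miss \<open>p\<close>, so a short enough move from
    \<open>p\<close> avoids them all and ends in a cone \<open>D\<close> containing
    \<open>p\<close>.\<close>
  define K where "K = \<Union>{D \<in> F. p \<notin> D}"
  have "closed K"
    unfolding K_def using \<open>fan F\<close> cone
    by (intro closed_Union) (auto simp: fan_def polyhedron_imp_closed)
  moreover have "p \<notin> K" by (auto simp: K_def)
  moreover have "((\<lambda>t. p + t *\<^sub>R v) \<longlongrightarrow> p + 0 *\<^sub>R v) (at_right 0)"
    by (intro tendsto_intros)
  ultimately have "\<forall>\<^sub>F t in at_right 0. p + t *\<^sub>R v \<in> - K"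
    by (intro topological_tendstoD) auto
  with ev eventually_at_right_less[of "0::real"]
  have "\<forall>\<^sub>F t in at_right 0. 0 < t \<and> p + t *\<^sub>R v \<in> fan_support F \<and> p + t *\<^sub>R v \<in> - K"
    by eventually_elim auto
  then obtain t where t: "0 < t" "p + t *\<^sub>R v \<in> fan_support F" "p + t *\<^sub>R v \<notin> K"
    using eventually_happens[of _ "at_right (0::real)"] by force
  then obtain D where D: "D \<in> F" "p \<in> D" "p + t *\<^sub>R v \<in> D"
    by (auto simp: K_def)
  have pC: "p \<in> C" using p rel_interior_subset by blast
  have "(C \<inter> D) face_of C" using \<open>fan F\<close> \<open>C \<in> F\<close> D(1) by (auto simp: fan_def)
  \<comment> \<open>A face of \<open>C\<close> that meets its relative interior, here at
    \<open>p\<close>, is all of \<open>C\<close>.\<close>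
  then have "C \<subseteq> C \<inter> D" by (rule subset_of_face_of) (use p pC D in auto)
  then have CD: "C \<subseteq> D" by blast
  have "convex C" "convex D"
    using cone \<open>C \<in> F\<close> D(1) by (auto simp: polyhedron_imp_convex)
  \<comment> \<open>The segment from \<open>p\<close> to \<open>q\<close> can be prolonged beyond
    \<open>q\<close> inside \<open>C\<close>.\<close>
  obtain e where e: "e > 1" "(1 - e) *\<^sub>R p + e *\<^sub>R q \<in> C"
    using convex_rel_interior_iff[of C q] \<open>convex C\<close> pC q by blast
  let ?r = "(1 - e) *\<^sub>R p + e *\<^sub>R q"
  \<comment> \<open>The weights give \<open>q\<close> coefficient 1 and cancel \<open>p\<close>,
    leaving \<open>q\<close> plus a positive multiple of \<open>v\<close>.\<close>
  have "(1 / e) *\<^sub>R ?r + (1 - 1 / e) *\<^sub>R (p + t *\<^sub>R v) \<in> D"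
    using e(1) by (intro convexD[OF \<open>convex D\<close> subsetD[OF CD e(2)] D(3)]) auto
  also have "(1 / e) *\<^sub>R ?r + (1 - 1 / e) *\<^sub>R (p + t *\<^sub>R v) = q + ((1 - 1 / e) * t) *\<^sub>R v"
  proof -
    have "(1 / e) * (1 - e) + (1 - 1 / e) = 0" using e(1) by (simp add: field_simps)
    then have "((1 / e) * (1 - e)) *\<^sub>R p + (1 - 1 / e) *\<^sub>R p = 0"
      by (simp only: scaleR_add_left[symmetric] scaleR_zero_left)
    then show ?thesis using e(1) by (simp add: scaleR_add_right)
  qed
  finally show ?thesis
    using e(1) t(1) D(1) by (intro exI[of _ "(1 - 1 / e) * t"]) auto
qed

text \<open>Larger index sets give smaller cones, so \<open>W_cone (argmins x)\<close> is the
  smallest cone containing \<open>x\<close> and has the least dimension.\<close>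

lemma mem_skeleton_iff:
  "x \<in> fan_support (W_skeleton m) \<longleftrightarrow> W_cone (argmins x) \<in> W_skeleton m"
proof
  assume "x \<in> fan_support (W_skeleton m)"
  then obtain B where B: "B \<subseteq> argmins x" "dim (W_cone B) \<le> m"
    by (auto simp: W_skeleton_def W_fan_def mem_W_cone_iff)
  then have "W_cone (argmins x) \<subseteq> W_cone B" by (auto simp: mem_W_cone_iff)
  with B(2) have "dim (W_cone (argmins x)) \<le> m" using dim_subset le_trans by blast
  then show "W_cone (argmins x) \<in> W_skeleton m"
    using argmins_nonempty by (auto simp: W_skeleton_def W_fan_def)
qed (use mem_W_cone_iff in blast)

theorem proposition3p7:
  fixes m :: nat and F :: "(real ^ 'n::finite) set set" and C :: "(real ^ 'n) set"
  assumes "0 < m" and "m < CARD('n)"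
    and "fan F"
    and "fan_support F = fan_support (W_skeleton m :: (real ^ 'n) set set)"
    and "C \<in> F"
  shows "\<exists>A::'n set. A \<noteq> {} \<and> W_cone A \<in> W_skeleton m \<and>
           rel_interior C \<subseteq> rel_interior (W_cone A)"
proof -
  \<comment> \<open>One inclusion for arbitrary \<open>p\<close> and \<open>q\<close> suffices:
    exchanging them gives equality.\<close>
  have sub: "argmins q \<subseteq> argmins p" if p: "p \<in> rel_interior C" and q: "q \<in> rel_interior C" for p q
  proof
    fix i assume i: "i \<in> argmins q"
    show "i \<in> argmins p"
    proof (rule ccontr)
      assume "i \<notin> argmins p"
      then have "\<forall>\<^sub>F t in at_right 0. argmins p \<subseteq> argmins (p - t *\<^sub>R axis i 1)"
        by (rule argmins_decrease_nonminimal)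
      moreover have "W_cone (argmins p) \<in> W_skeleton m"
        using p rel_interior_subset \<open>C \<in> F\<close> assms(4) mem_skeleton_iff by blast
      ultimately have "\<forall>\<^sub>F t in at_right 0. p + t *\<^sub>R (- axis i 1) \<in> fan_support F"
        unfolding assms(4)
        by (auto elim!: eventually_mono intro!: bexI[of _ "W_cone (argmins p)"] simp: mem_W_cone_iff)
      then have "\<exists>s>0. q + s *\<^sub>R (- axis i 1) \<in> fan_support F"
        by (rule fan_directions_constant[OF \<open>fan F\<close> \<open>C \<in> F\<close> p q])
      then obtain s where "s > 0" "q - s *\<^sub>R axis i 1 \<in> fan_support F"
        by auto
      \<comment> \<open>After the move \<open>i\<close> is the only minimal coordinate, which would
        put a cone of full dimension, greater than \<open>m\<close>, into the skeleton.\<close>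
      then have "W_cone {i} \<in> W_skeleton m"
        using argmins_decrease_minimal[OF i] assms(4) by (metis mem_skeleton_iff)
      then show False
        using assms(2) by (simp add: W_skeleton_def dim_W_cone_singleton)
    qed
  qed
  have "convex C" "C \<noteq> {}"
    using \<open>fan F\<close> \<open>C \<in> F\<close> by (auto simp: fan_def polyhedral_cone_def polyhedron_imp_convex)
  then obtain p where p: "p \<in> rel_interior C"
    using rel_interior_eq_empty by blast
  show ?thesis
  proof (intro exI conjI subsetI)
    show "argmins p \<noteq> {}" by (rule argmins_nonempty)
    show "W_cone (argmins p) \<in> W_skeleton m"
      using p rel_interior_subset \<open>C \<in> F\<close> assms(4) mem_skeleton_iff by blast
    show "q \<in> rel_interior (W_cone (argmins p))" if "q \<in> rel_interior C" for q
      using sub[OF p that] sub[OF that p]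
      by (intro mem_rel_interior_W_cone argmins_nonempty) auto
  qed
qed

end
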